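(* The moment function $\psi(W,\gamma,\alpha,\theta)=g(W,\gamma,\theta)+\alpha(X)\lambda(W,\gamma)$ is doubly robust over $\gamma\in\Gamma$ if and only if $$E[g(W,\gamma,\theta_0)]=-E[\alpha_0(X)\lambda(W,\gamma)]\quad\text{for all }\gamma\in\Gamma.$$
   Context: $g(w,\gamma,\theta)$ is a vector of identifying moment functions with $E[g(W,\gamma_0,\theta_0)]=0$. The first step $\gamma_0$ satisfies the conditional moment restriction $E[\lambda(W,\gamma_0)|X]=0$, where $\lambda(W,\gamma)$ is a scalar functional of $\gamma$ that is affine in $\gamma$ and $X$ (a subvector of $W$) are regressors or instrumental variables. $\Gamma$ is a set of possible first steps $\gamma$; $\alpha$ ranges over functions of $X$ for which the expectations exist; $\gamma_0,\alpha_0,\theta_0$ are the true values. With $\bar\psi(\gamma,\alpha,\theta)=E[\psi(W,\gamma,\alpha,\theta)]$, $\psi$ is doubly robust over $\Gamma$ if $0=\bar\psi(\gamma,\alpha_0,\theta_0)=\bar\psi(\gamma_0,\alpha,\theta_0)$ for all $\gamma\in\Gamma$ and all $\alpha$. *)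

theory Defs
  imports "HOL-Probability.Probability"
begin

definition subvector :: "('k::finite \<Rightarrow> 'n::finite) \<Rightarrow> real ^ 'n \<Rightarrow> real ^ 'k" where
  "subvector s w = (\<chi> i. w $ s i)"

definition affine_functional :: "('c::real_vector \<Rightarrow> real) \<Rightarrow> bool" where
  "affine_functional f \<longleftrightarrow> (\<exists>L c. linear L \<and> (\<forall>\<gamma>. f \<gamma> = L \<gamma> + c))"

definition sigma_gen :: "'a measure \<Rightarrow> ('a \<Rightarrow> real ^ 'k) \<Rightarrow> 'a measure" where
  "sigma_gen M X = vimage_algebra (space M) X borel"

definition psi ::
  "(real ^ 'n \<Rightarrow> 'c \<Rightarrow> 't \<Rightarrow> real ^ 'm) \<Rightarrow> (real ^ 'n \<Rightarrow> 'c \<Rightarrow> real) \<Rightarrow> ('k::finite \<Rightarrow> 'n::finite)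
   \<Rightarrow> real ^ 'n \<Rightarrow> 'c \<Rightarrow> (real ^ 'k \<Rightarrow> real ^ 'm) \<Rightarrow> 't \<Rightarrow> real ^ 'm" where
  "psi g lam s w \<gamma> \<alpha> \<theta> = g w \<gamma> \<theta> + lam w \<gamma> *\<^sub>R \<alpha> (subvector s w)"

definition psi_bar ::
  "'a measure \<Rightarrow> ('a \<Rightarrow> real ^ 'n)
   \<Rightarrow> (real ^ 'n \<Rightarrow> 'c \<Rightarrow> (real ^ 'k \<Rightarrow> real ^ 'm) \<Rightarrow> 't \<Rightarrow> real ^ 'm)
   \<Rightarrow> 'c \<Rightarrow> (real ^ 'k \<Rightarrow> real ^ 'm) \<Rightarrow> 't \<Rightarrow> real ^ 'm" where
  "psi_bar M W \<psi> \<gamma> \<alpha> \<theta> = (\<integral>\<omega>. \<psi> (W \<omega>) \<gamma> \<alpha> \<theta> \<partial>M)"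

(* The Bochner integral is 0 on non-integrable functions, so the existence of each expectation
   is stated separately: it is part of the condition at alpha0, and it delimits the class over
   which alpha ranges at gamma0. *)
definition doubly_robust ::
  "'a measure \<Rightarrow> ('a \<Rightarrow> real ^ 'n)
   \<Rightarrow> (real ^ 'n \<Rightarrow> 'c \<Rightarrow> (real ^ 'k \<Rightarrow> real ^ 'm) \<Rightarrow> 't \<Rightarrow> real ^ 'm)
   \<Rightarrow> 'c set \<Rightarrow> 'c \<Rightarrow> (real ^ 'k \<Rightarrow> real ^ 'm) \<Rightarrow> 't \<Rightarrow> bool" where
  "doubly_robust M W \<psi> \<Gamma> \<gamma>0 \<alpha>0 \<theta>0 \<longleftrightarrow>
     (\<forall>\<gamma>\<in>\<Gamma>. integrable M (\<lambda>\<omega>. \<psi> (W \<omega>) \<gamma> \<alpha>0 \<theta>0) \<and> psi_bar M W \<psi> \<gamma> \<alpha>0 \<theta>0 = 0) \<and>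
     (\<forall>\<alpha>\<in>borel_measurable borel.
        integrable M (\<lambda>\<omega>. \<psi> (W \<omega>) \<gamma>0 \<alpha> \<theta>0) \<longrightarrow> psi_bar M W \<psi> \<gamma>0 \<alpha> \<theta>0 = 0)"

end

theory Submission
  imports Defs
begin

text \<open>
  The condition at \<open>\<alpha>0\<close> is a rearrangement of the displayed equation. The condition at \<open>\<gamma>0\<close>
  holds unconditionally: \<open>\<alpha>(X)\<close> is \<open>\<sigma>(X)\<close>-measurable, so the conditional moment restriction makes
  every \<open>\<alpha>(X)\<close> orthogonal to \<open>\<lambda>(W, \<gamma>0)\<close>. Integrability of \<open>\<lambda>(W, \<gamma>0) \<alpha>(X)\<close> follows from
  that of \<open>\<psi>\<close> and of \<open>g\<close> at \<open>\<gamma>0\<close>.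
\<close>

text \<open>Measurability of \<open>X\<close> enters here: it places \<open>sigma_gen M X\<close>
  inside \<open>M\<close>, as conditioning on \<open>X\<close> requires.\<close>

lemma subalgebra_sigma_gen:
  fixes X :: "'a \<Rightarrow> real ^ 'k::finite"
  assumes "X \<in> borel_measurable M"
  shows "subalgebra M (sigma_gen M X)"
  using assms
  by (auto simp: subalgebra_def sigma_gen_def sets_vimage_algebra2 measurable_sets)

text \<open>An \<open>F\<close>-measurable factor can be moved inside a conditional expectation
  given \<open>F\<close>. As \<open>real_cond_exp\<close> is for real functions, this is applied to
  each coordinate of \<open>f\<close>.\<close>

lemma integral_scaleR_cond_exp_zero:
  fixes u :: "'a \<Rightarrow> real" and f :: "'a \<Rightarrow> real ^ 'm::finite"
  assumes "finite_measure M" and sub: "subalgebra M F"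
    and f [measurable]: "f \<in> borel_measurable F"
    and u [measurable]: "u \<in> borel_measurable M"
    and zero: "AE \<omega> in M. real_cond_exp M F u \<omega> = 0"
    and int: "integrable M (\<lambda>\<omega>. u \<omega> *\<^sub>R f \<omega>)"
  shows "(\<integral>\<omega>. u \<omega> *\<^sub>R f \<omega> \<partial>M) = 0"
proof -
  interpret finite_measure M by fact
  interpret finite_measure_subalgebra M F
    by unfold_locales fact
  have "(\<integral>\<omega>. u \<omega> *\<^sub>R f \<omega> \<partial>M) $ i = 0" for i
  proof -
    \<comment> \<open>Coordinate projection is bounded linear, so it preserves integrability and, at
      the end, commutes with the integral.\<close>
    have comp: "integrable M (\<lambda>\<omega>. f \<omega> $ i * u \<omega>)"
      using integrable_bounded_linear[OF bounded_linear_vec_nth int, of i]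
      by (simp add: mult.commute)
    have "(\<lambda>\<omega>. f \<omega> $ i) \<in> borel_measurable F"
      by (rule borel_measurable_continuous_on[OF _ f]) (intro continuous_intros)
    then have "(\<integral>\<omega>. f \<omega> $ i * u \<omega> \<partial>M) = (\<integral>\<omega>. f \<omega> $ i * real_cond_exp M F u \<omega> \<partial>M)"
      using real_cond_exp_intg(2)[OF comp _ u] by simp
    also have "\<dots> = 0"
      using zero by (intro integral_eq_zero_AE) auto
    finally show ?thesis
      using integral_bounded_linear[OF bounded_linear_vec_nth int, of i]
      by (simp add: mult.commute)
  qed
  then show ?thesis by (simp add: vec_eq_iff)
qed

theorem theorem8:
  fixes M :: "'a measure"
    and W :: "'a \<Rightarrow> real ^ 'n::finite"
    and s :: "'k::finite \<Rightarrow> 'n"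
    and X :: "'a \<Rightarrow> real ^ 'k"
    and g :: "real ^ 'n \<Rightarrow> 'c::real_vector \<Rightarrow> 't \<Rightarrow> real ^ 'm::finite"
    and lam :: "real ^ 'n \<Rightarrow> 'c \<Rightarrow> real"
    and \<Gamma> :: "'c set" and \<gamma>0 :: 'c
    and \<alpha>0 :: "real ^ 'k \<Rightarrow> real ^ 'm" and \<theta>0 :: 't
  assumes "prob_space M"
    and "W \<in> borel_measurable M"
    and "inj s" and "\<And>\<omega>. X \<omega> = subvector s (W \<omega>)"
    and "\<And>w. affine_functional (lam w)"
    and "integrable M (\<lambda>\<omega>. g (W \<omega>) \<gamma>0 \<theta>0)"
    and "(\<integral>\<omega>. g (W \<omega>) \<gamma>0 \<theta>0 \<partial>M) = 0"
    and "integrable M (\<lambda>\<omega>. lam (W \<omega>) \<gamma>0)"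
    and "AE \<omega> in M. real_cond_exp M (sigma_gen M X) (\<lambda>\<omega>. lam (W \<omega>) \<gamma>0) \<omega> = 0"
    and "\<alpha>0 \<in> borel_measurable borel"
    and "\<And>\<gamma>. \<gamma> \<in> \<Gamma> \<Longrightarrow> integrable M (\<lambda>\<omega>. g (W \<omega>) \<gamma> \<theta>0)"
    and "\<And>\<gamma>. \<gamma> \<in> \<Gamma> \<Longrightarrow> integrable M (\<lambda>\<omega>. lam (W \<omega>) \<gamma> *\<^sub>R \<alpha>0 (X \<omega>))"
  shows "doubly_robust M W (psi g lam s) \<Gamma> \<gamma>0 \<alpha>0 \<theta>0 \<longleftrightarrow>
    (\<forall>\<gamma>\<in>\<Gamma>. (\<integral>\<omega>. g (W \<omega>) \<gamma> \<theta>0 \<partial>M) = - (\<integral>\<omega>. lam (W \<omega>) \<gamma> *\<^sub>R \<alpha>0 (X \<omega>) \<partial>M))"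
proof -
  interpret prob_space M by fact
  \<comment> \<open>Selecting coordinates is continuous, so \<open>X\<close> inherits measurability
    from \<open>W\<close>.\<close>
  have X_eq: "X = (\<lambda>\<omega>. \<chi> i. W \<omega> $ s i)"
    using assms(4) by (auto simp: subvector_def)
  have X [measurable]: "X \<in> borel_measurable M"
    unfolding X_eq
    by (intro borel_measurable_continuous_on[OF _ assms(2)] continuous_intros)
  have psi: "psi g lam s (W \<omega>) \<gamma> \<alpha> \<theta> = g (W \<omega>) \<gamma> \<theta> + lam (W \<omega>) \<gamma> *\<^sub>R \<alpha> (X \<omega>)" for \<omega> \<gamma> \<alpha> \<theta>
    by (simp add: psi_def assms(4))
  have "psi_bar M W (psi g lam s) \<gamma>0 \<alpha> \<theta>0 = 0"
    if \<alpha>: "\<alpha> \<in> borel_measurable borel"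
      and int: "integrable M (\<lambda>\<omega>. psi g lam s (W \<omega>) \<gamma>0 \<alpha> \<theta>0)" for \<alpha>
  proof -
    have int': "integrable M (\<lambda>\<omega>. lam (W \<omega>) \<gamma>0 *\<^sub>R \<alpha> (X \<omega>))"
      using Bochner_Integration.integrable_diff[OF int assms(6)] by (simp add: psi)
    \<comment> \<open>\<open>sigma_gen M X\<close> consists of preimages of Borel sets under
      \<open>X\<close>; composing with the Borel map \<open>\<alpha>\<close> keeps
      measurability.\<close>
    have "X \<in> borel_measurable (sigma_gen M X)"
      unfolding sigma_gen_def by (rule measurable_vimage_algebra1) simp
    then have "(\<lambda>\<omega>. \<alpha> (X \<omega>)) \<in> borel_measurable (sigma_gen M X)"
      using \<alpha> by (rule measurable_compose)
    then have "(\<integral>\<omega>. lam (W \<omega>) \<gamma>0 *\<^sub>R \<alpha> (X \<omega>) \<partial>M) = 0"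
      using assms(8,9) int' finite_measure_axioms subalgebra_sigma_gen[OF X]
      by (intro integral_scaleR_cond_exp_zero) auto
    then show ?thesis
      using assms(6,7) int' by (simp add: psi_bar_def psi)
  qed
  \<comment> \<open>Both summands are integrable over \<Gamma>, so the integrability clause of
    \<open>doubly_robust\<close> holds and the integral splits. What remains of double robustness is
    that this sum of two expectations vanishes.\<close>
  moreover have "integrable M (\<lambda>\<omega>. psi g lam s (W \<omega>) \<gamma> \<alpha>0 \<theta>0)"
    and "psi_bar M W (psi g lam s) \<gamma> \<alpha>0 \<theta>0
      = (\<integral>\<omega>. g (W \<omega>) \<gamma> \<theta>0 \<partial>M) + (\<integral>\<omega>. lam (W \<omega>) \<gamma> *\<^sub>R \<alpha>0 (X \<omega>) \<partial>M)"
    if "\<gamma> \<in> \<Gamma>" for \<gamma>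
    using assms(11,12)[OF that] by (simp_all add: psi_bar_def psi)
  ultimately show ?thesis
    by (auto simp: doubly_robust_def eq_neg_iff_add_eq_0)
qed

end
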